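(* Let $\lambda$ be a nonzero real number. For every integer $n\ge 0$, $$\sum_{j=0}^{n}\sum_{l=0}^{j}\binom{n}{j}(1)_{n-j,\lambda}(-1)^{l}d_{l,\lambda}(x)S_{2,\lambda}(j,l)=\sum_{j=0}^{n}(x-1)_{j,\lambda}(-1)^{j}S_{2,\lambda}(n,j).$$
   Context: For a nonzero real $\lambda$, the degenerate falling factorial is $(x)_{0,\lambda}=1$ and $(x)_{n,\lambda}=x(x-\lambda)\cdots(x-(n-1)\lambda)$ for $n\ge1$. The degenerate exponential function is $e_{\lambda}^{x}(t)=(1+\lambda t)^{x/\lambda}=\sum_{n\ge0}(x)_{n,\lambda}\frac{t^n}{n!}$, and $e_\lambda(t)=e_\lambda^1(t)$. The degenerate derangement polynomials $d_{n,\lambda}(x)$ are defined by $\frac{1}{1-t}e_{\lambda}^{x-1}(t)=\sum_{n\ge0}d_{n,\lambda}(x)\frac{t^n}{n!}$. The degenerate Stirling numbers of the second kind $S_{2,\lambda}(n,m)$ are defined by $\frac{1}{m!}(e_{\lambda}(t)-1)^m=\sum_{n\ge m}S_{2,\lambda}(n,m)\frac{t^n}{n!}$ for $m\ge0$ (equivalently $(x)_{n,\lambda}=\sum_{l=0}^n S_{2,\lambda}(n,l)(x)_l$ with $(x)_l$ the ordinary falling factorial), with $S_{2,\lambda}(n,m)=0$ for $m>n$. *)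

theory Defs
  imports "HOL-Analysis.Analysis"
begin

definition deg_ffact :: "real \<Rightarrow> real \<Rightarrow> nat \<Rightarrow> real" where
  "deg_ffact lam x n = (\<Prod>i<n. x - real i * lam)"

text \<open>
  The degenerate exponential is a formal power series in \<open>t\<close>; the lemma
  \<open>deg_exp_sums\<close> below identifies its sum with \<open>(1 + lam t) powr (x / lam)\<close>.
\<close>

definition deg_exp :: "real \<Rightarrow> real \<Rightarrow> real fps" where
  "deg_exp lam x = Abs_fps (\<lambda>n. deg_ffact lam x n / fact n)"

text \<open>
  The next two families are given by exponential generating functions, so the \<open>n\<close>-th member
  is \<open>n!\<close> times the \<open>n\<close>-th coefficient.
\<close>

definition deg_derangement :: "real \<Rightarrow> nat \<Rightarrow> real \<Rightarrow> real" where
  "deg_derangement lam n x = fact n * fps_nth (1 / (1 - fps_X) * deg_exp lam (x - 1)) n"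

definition deg_Stirling2 :: "real \<Rightarrow> nat \<Rightarrow> nat \<Rightarrow> real" where
  "deg_Stirling2 lam n m =
     fact n * fps_nth (fps_const (1 / fact m) * (deg_exp lam 1 - 1) ^ m) n"

lemma deg_ffact_conv_gbinomial:
  assumes "lam \<noteq> 0"
  shows "deg_ffact lam x n / fact n = ((x / lam) gchoose n) * lam ^ n"
proof -
  have "deg_ffact lam x n = (\<Prod>i<n. (x / lam - real i) * lam)"
    unfolding deg_ffact_def using assms by (intro prod.cong) (auto simp: field_simps)
  also have "\<dots> = (\<Prod>i=0..<n. x / lam - real i) * lam ^ n"
    by (simp add: prod.distrib atLeast0LessThan)
  finally show ?thesis
    by (simp add: gbinomial_prod_rev)
qed

lemma deg_exp_sums:
  assumes "lam \<noteq> 0" and "\<bar>lam * t\<bar> < 1"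
  shows "(\<lambda>n. fps_nth (deg_exp lam x) n * t ^ n) sums ((1 + lam * t) powr (x / lam))"
  using gen_binomial_real[OF assms(2), of "x / lam"]
  by (simp add: deg_exp_def deg_ffact_conv_gbinomial[OF assms(1)] power_mult_distrib mult_ac)

lemma deg_derangement_egf:
  "1 / (1 - fps_X) * deg_exp lam (x - 1) = Abs_fps (\<lambda>n. deg_derangement lam n x / fact n)"
  by (rule fps_ext) (simp add: deg_derangement_def)

lemma deg_Stirling2_egf:
  "fps_const (1 / fact m) * (deg_exp lam 1 - 1) ^ m = Abs_fps (\<lambda>n. deg_Stirling2 lam n m / fact n)"
  by (rule fps_ext) (simp add: deg_Stirling2_def)

lemma deg_Stirling2_eq_0:
  assumes "m > n"
  shows "deg_Stirling2 lam n m = 0"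
proof -
  have "fps_nth (deg_exp lam 1 - 1) 0 = 0"
    by (simp add: deg_exp_def deg_ffact_def)
  then show ?thesis
    using assms startsby_zero_power_prefix[of "deg_exp lam 1 - 1" m]
    by (simp add: deg_Stirling2_def)
qed

end

theory Submission
  imports Defs
begin

text \<open>
  Put \<open>u = e\<^sub>\<lambda>(t) - 1\<close>. Composing an exponential generating function with \<open>-u\<close> turns its
  coefficients \<open>a\<^sub>l\<close> into \<open>\<Sum>\<^sub>l (-1)\<^sup>l a\<^sub>l S\<^sub>2\<^sub>,\<^sub>\<lambda>(n,l)\<close>. Substituting \<open>-u\<close> for \<open>t\<close> in
  \<open>(1 - t) \<Sum> d\<^sub>l\<^sub>,\<^sub>\<lambda>(x) t\<^sup>l / l! = e\<^sub>\<lambda>\<^sup>x\<^sup>-\<^sup>1(t)\<close> makes the factor \<open>1 - t\<close> into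
  \<open>1 + u = e\<^sub>\<lambda>(t)\<close>, and the theorem compares the coefficients of both sides.
\<close>

lemma fps_nth_egf_compose_deg_exp:
  "fps_nth (Abs_fps (\<lambda>l. a l / fact l) oo (1 - deg_exp lam 1)) n =
     (\<Sum>l=0..n. (-1) ^ l * a l * deg_Stirling2 lam n l) / fact n"
proof -
  \<comment> \<open>With the sign split off, the \<open>1 / fact l\<close> of the generating
    function is the normalisation in \<open>deg_Stirling2_def\<close>.\<close>
  have "(1 - deg_exp lam 1) ^ l = fps_const ((-1) ^ l) * (deg_exp lam 1 - 1) ^ l" for l
    using power_minus[of "deg_exp lam 1 - 1" l]
    by (simp flip: fps_const_power fps_const_neg)
  then show ?thesis
    by (simp add: fps_compose_nth deg_Stirling2_def sum_divide_distrib mult_ac)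
qed

lemma deg_exp_mult_derangement_compose:
  "deg_exp lam 1 * (Abs_fps (\<lambda>n. deg_derangement lam n x / fact n) oo (1 - deg_exp lam 1)) =
     deg_exp lam (x - 1) oo (1 - deg_exp lam 1)"
proof -
  let ?u = "1 - deg_exp lam 1"
  let ?D = "Abs_fps (\<lambda>n. deg_derangement lam n x / fact n)"
  \<comment> \<open>A zero constant term makes composition with \<open>?u\<close> multiplicative and
    gives \<open>fps_X oo ?u = ?u\<close>.\<close>
  have u0: "fps_nth ?u 0 = 0"
    by (simp add: deg_exp_def deg_ffact_def)
  have "(1 - fps_X) * (1 / (1 - fps_X)) = (1 :: real fps)"
    by (simp add: fps_divide_unit inverse_mult_eq_1')
  then have "(1 - fps_X) * ?D = deg_exp lam (x - 1)"
    by (simp flip: deg_derangement_egf mult.assoc)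
  then have "((1 - fps_X) oo ?u) * (?D oo ?u) = deg_exp lam (x - 1) oo ?u"
    by (metis fps_compose_mult_distrib[OF u0])
  then show ?thesis
    by (simp only: fps_compose_sub_distrib fps_compose_1 fps_X_fps_compose_startby0[OF u0] diff_diff_eq2 add_diff_cancel_left')
qed

theorem theorem3:
  fixes lam x :: real and n :: nat
  assumes "lam \<noteq> 0"
  shows "(\<Sum>j=0..n. \<Sum>l=0..j. real (n choose j) * deg_ffact lam 1 (n - j) * (-1) ^ l
            * deg_derangement lam l x * deg_Stirling2 lam j l)
       = (\<Sum>j=0..n. deg_ffact lam (x - 1) j * (-1) ^ j * deg_Stirling2 lam n j)"
    (is "?L = ?R")
proof -
  let ?u = "1 - deg_exp lam 1"
  let ?D = "Abs_fps (\<lambda>n. deg_derangement lam n x / fact n)"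
  \<comment> \<open>\<open>deg_exp lam 1\<close> stands second so that the Cauchy product gives it
    the index \<open>n - j\<close>; \<open>fact n\<close> then turns the factorials into
    \<open>n choose j\<close>.\<close>
  have "?L = fact n * fps_nth ((?D oo ?u) * deg_exp lam 1) n"
    unfolding fps_mult_nth fps_nth_egf_compose_deg_exp sum_distrib_left
    by (intro sum.cong refl)
      (simp add: deg_exp_def binomial_fact sum_distrib_left sum_distrib_right
        sum_divide_distrib mult_ac)
  also have "\<dots> = fact n * fps_nth (deg_exp lam (x - 1) oo ?u) n"
    by (simp add: deg_exp_mult_derangement_compose mult.commute)
  also have "\<dots> = ?R"
    unfolding deg_exp_def[of lam "x - 1"] fps_nth_egf_compose_deg_exp
    by (simp add: mult_ac)
  finally show ?thesis .
qed

end
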